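(* Let $\Gamma_0=(V_0,E_0)$ and $\Gamma_1=(V_1,E_1)$ be word graphs over $A$ representing right congruences $\rho_0$ and $\rho_1$, respectively, of the monoid $M$ defined by the presentation $\langle A\mid R\rangle$. Then the meet word graph $\Gamma_2$ of $\Gamma_0$ and $\Gamma_1$ (with distinguished node $(0,0)$ in the role of $0$) represents the meet $\rho_0\wedge\rho_1$ of $\rho_0$ and $\rho_1$.
   Context: Functions are written to the right of their arguments. $A$ is an alphabet, $A^*$ the free monoid on $A$ with identity the empty word $\varepsilon$, $R\subseteq A^*\times A^*$, $R^{\#}$ the least 2-sided congruence on $A^*$ containing $R$, $M\cong A^*/R^{\#}$, and $\theta:A^*\to M$ the natural surjective homomorphism with $\ker(\theta)=R^{\#}$. For $T\subseteq A^*\times A^*$ write $(T)\theta=\{((u)\theta,(v)\theta):(u,v)\in T\}$. The meet $\rho_0\wedge\rho_1$ is the greatest right congruence contained in both, i.e. $\rho_0\cap\rho_1$. A word graph over $A$ is a digraph $\Gamma=(V,E)$ with $E\subseteq V\times A\times V$. It is complete (respectively deterministic) if for every node $\alpha$ and $a\in A$ there is at least (respectively at most) one edge with source $\alpha$ and label $a$. Write $\alpha\cdot u=\beta$ if $u\in A^*$ labels a path from $\alpha$ to $\beta$ (the empty path being labelled by $\varepsilon$), and $\alpha\cdot u=\bot$ if $u$ labels no path with source $\alpha$; $(\alpha)\pi_\Gamma=\{(u,v):\alpha\cdot u\ne\bot,\ \alpha\cdot u=\alpha\cdot v\}$. $\Gamma$ is compatible with $R$ if for all $(u,v)\in R$ and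 $\alpha\in V$, $\alpha\cdot u=\alpha\cdot v$ whenever both are $\neq\bot$. A word graph $\Gamma$ with distinguished node $0$ represents the right congruence $\rho$ of $M$ if $\Gamma$ is complete, deterministic, compatible with $R$, every node is reachable from $0$, and $\rho=((0)\pi_\Gamma)\theta$. The meet word graph $\Gamma_2=(V_2,E_2)$ of $\Gamma_0$ and $\Gamma_1$: $V_2$ is the largest subset of $V_0\times V_1$ such that every node in $V_2$ is reachable from $(0,0)$ in $\Gamma_2$, and $((\alpha_0,\alpha_1),a,(\beta_0,\beta_1))\in E_2$ if and only if $(\alpha_0,a,\beta_0)\in E_0$ and $(\alpha_1,a,\beta_1)\in E_1$. *)

theory Defs
  imports "HOL-Algebra.Group"
begin

section \<open>Congruences and presentations of monoids\<close>

definition right_congruence :: "('m, 'x) monoid_scheme \<Rightarrow> ('m \<times> 'm) set \<Rightarrow> bool" where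
  "right_congruence M \<rho> \<longleftrightarrow> equiv (carrier M) \<rho> \<and>
     (\<forall>(x, y)\<in>\<rho>. \<forall>s\<in>carrier M. (x \<otimes>\<^bsub>M\<^esub> s, y \<otimes>\<^bsub>M\<^esub> s) \<in> \<rho>)"

definition two_sided_congruence :: "('m, 'x) monoid_scheme \<Rightarrow> ('m \<times> 'm) set \<Rightarrow> bool" where
  "two_sided_congruence M \<rho> \<longleftrightarrow> right_congruence M \<rho> \<and>
     (\<forall>(x, y)\<in>\<rho>. \<forall>s\<in>carrier M. (s \<otimes>\<^bsub>M\<^esub> x, s \<otimes>\<^bsub>M\<^esub> y) \<in> \<rho>)"

definition right_congruence_meet ::
  "('m, 'x) monoid_scheme \<Rightarrow> ('m \<times> 'm) set \<Rightarrow> ('m \<times> 'm) set \<Rightarrow> ('m \<times> 'm) set" where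
  "right_congruence_meet M \<rho>\<^sub>0 \<rho>\<^sub>1 =
     (GREATEST \<sigma>. right_congruence M \<sigma> \<and> \<sigma> \<subseteq> \<rho>\<^sub>0 \<and> \<sigma> \<subseteq> \<rho>\<^sub>1)"

definition free_monoid :: "'a set \<Rightarrow> 'a list monoid" where
  "free_monoid A = \<lparr>carrier = lists A, monoid.mult = (@), one = []\<rparr>"

definition generated_congruence ::
  "'a set \<Rightarrow> ('a list \<times> 'a list) set \<Rightarrow> ('a list \<times> 'a list) set" where
  "generated_congruence A R = (LEAST \<sigma>. two_sided_congruence (free_monoid A) \<sigma> \<and> R \<subseteq> \<sigma>)"

text \<open>
  The monoid \<open>M\<close> is presented by \<open>\<langle>A | R\<rangle>\<close>, where \<open>\<theta>\<close> is the natural homomorphism onto \<open>M\<close>;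
  only the values of \<open>\<theta>\<close> on words over \<open>A\<close> matter.
\<close>
definition presents ::
  "'a set \<Rightarrow> ('a list \<times> 'a list) set \<Rightarrow> ('m, 'x) monoid_scheme \<Rightarrow> ('a list \<Rightarrow> 'm) \<Rightarrow> bool" where
  "presents A R M \<theta> \<longleftrightarrow>
     R \<subseteq> lists A \<times> lists A \<and>
     monoid M \<and>
     \<theta> \<in> hom (free_monoid A) M \<and> \<theta> [] = \<one>\<^bsub>M\<^esub> \<and>
     \<theta> ` lists A = carrier M \<and>
     {(u, v). u \<in> lists A \<and> v \<in> lists A \<and> \<theta> u = \<theta> v} = generated_congruence A R"

section \<open>Word graphs\<close>

record ('v, 'a) word_graph =
  nodes :: "'v set"
  edges :: "('v \<times> 'a \<times> 'v) set"

definition is_word_graph :: "'a set \<Rightarrow> ('v, 'a) word_graph \<Rightarrow> bool" where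
  "is_word_graph A \<Gamma> \<longleftrightarrow> edges \<Gamma> \<subseteq> nodes \<Gamma> \<times> A \<times> nodes \<Gamma>"

definition complete_word_graph :: "'a set \<Rightarrow> ('v, 'a) word_graph \<Rightarrow> bool" where
  "complete_word_graph A \<Gamma> \<longleftrightarrow> (\<forall>\<alpha>\<in>nodes \<Gamma>. \<forall>a\<in>A. \<exists>\<beta>. (\<alpha>, a, \<beta>) \<in> edges \<Gamma>)"

definition deterministic_word_graph :: "'a set \<Rightarrow> ('v, 'a) word_graph \<Rightarrow> bool" where
  "deterministic_word_graph A \<Gamma> \<longleftrightarrow>
     (\<forall>\<alpha>\<in>nodes \<Gamma>. \<forall>a\<in>A. \<forall>\<beta> \<beta>'. (\<alpha>, a, \<beta>) \<in> edges \<Gamma> \<and> (\<alpha>, a, \<beta>') \<in> edges \<Gamma> \<longrightarrow> \<beta> = \<beta>')"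

inductive labels_path :: "('v, 'a) word_graph \<Rightarrow> 'v \<Rightarrow> 'a list \<Rightarrow> 'v \<Rightarrow> bool" for \<Gamma> where
  Nil: "\<alpha> \<in> nodes \<Gamma> \<Longrightarrow> labels_path \<Gamma> \<alpha> [] \<alpha>"
| Cons: "(\<alpha>, a, \<beta>) \<in> edges \<Gamma> \<Longrightarrow> labels_path \<Gamma> \<beta> u \<gamma> \<Longrightarrow> labels_path \<Gamma> \<alpha> (a # u) \<gamma>"

definition reachable :: "('v, 'a) word_graph \<Rightarrow> 'v \<Rightarrow> 'v \<Rightarrow> bool" where
  "reachable \<Gamma> \<alpha> \<beta> \<longleftrightarrow> (\<exists>u. labels_path \<Gamma> \<alpha> u \<beta>)"

text \<open>
  The node \<open>\<alpha> \<cdot> u\<close>, with \<^term>\<open>None\<close> in the role of \<open>\<bottom>\<close>. For this to be meaningful the end point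
  of a path must be determined by its source and label; it is only used for deterministic
  word graphs.
\<close>
definition act :: "('v, 'a) word_graph \<Rightarrow> 'v \<Rightarrow> 'a list \<Rightarrow> 'v option" where
  "act \<Gamma> \<alpha> u =
     (if \<exists>\<beta>. labels_path \<Gamma> \<alpha> u \<beta> then Some (THE \<beta>. labels_path \<Gamma> \<alpha> u \<beta>) else None)"

definition path_relation :: "('v, 'a) word_graph \<Rightarrow> 'v \<Rightarrow> ('a list \<times> 'a list) set" where
  "path_relation \<Gamma> \<alpha> = {(u, v). act \<Gamma> \<alpha> u \<noteq> None \<and> act \<Gamma> \<alpha> u = act \<Gamma> \<alpha> v}"

definition compatible :: "('v, 'a) word_graph \<Rightarrow> ('a list \<times> 'a list) set \<Rightarrow> bool" where
  "compatible \<Gamma> R \<longleftrightarrow> (\<forall>(u, v)\<in>R. \<forall>\<alpha>\<in>nodes \<Gamma>.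
     act \<Gamma> \<alpha> u \<noteq> None \<and> act \<Gamma> \<alpha> v \<noteq> None \<longrightarrow> act \<Gamma> \<alpha> u = act \<Gamma> \<alpha> v)"

definition represents ::
  "'a set \<Rightarrow> ('a list \<times> 'a list) set \<Rightarrow> ('m, 'x) monoid_scheme \<Rightarrow> ('a list \<Rightarrow> 'm) \<Rightarrow>
   ('v, 'a) word_graph \<Rightarrow> 'v \<Rightarrow> ('m \<times> 'm) set \<Rightarrow> bool" where
  "represents A R M \<theta> \<Gamma> z \<rho> \<longleftrightarrow>
     right_congruence M \<rho> \<and>
     is_word_graph A \<Gamma> \<and> z \<in> nodes \<Gamma> \<and>
     complete_word_graph A \<Gamma> \<and> deterministic_word_graph A \<Gamma> \<and> compatible \<Gamma> R \<and>
     (\<forall>\<alpha>\<in>nodes \<Gamma>. reachable \<Gamma> z \<alpha>) \<and>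
     \<rho> = map_prod \<theta> \<theta> ` path_relation \<Gamma> z"

section \<open>The meet word graph\<close>

definition product_graph_on ::
  "('v \<times> 'w) set \<Rightarrow> ('v, 'a) word_graph \<Rightarrow> ('w, 'a) word_graph \<Rightarrow> ('v \<times> 'w, 'a) word_graph" where
  "product_graph_on W \<Gamma>\<^sub>0 \<Gamma>\<^sub>1 =
     \<lparr>nodes = W,
      edges = {((\<alpha>\<^sub>0, \<alpha>\<^sub>1), a, (\<beta>\<^sub>0, \<beta>\<^sub>1)) | \<alpha>\<^sub>0 \<alpha>\<^sub>1 a \<beta>\<^sub>0 \<beta>\<^sub>1.
        (\<alpha>\<^sub>0, \<alpha>\<^sub>1) \<in> W \<and> (\<beta>\<^sub>0, \<beta>\<^sub>1) \<in> W \<and>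
        (\<alpha>\<^sub>0, a, \<beta>\<^sub>0) \<in> edges \<Gamma>\<^sub>0 \<and> (\<alpha>\<^sub>1, a, \<beta>\<^sub>1) \<in> edges \<Gamma>\<^sub>1}\<rparr>"

definition meet_nodes ::
  "('v, 'a) word_graph \<Rightarrow> 'v \<Rightarrow> ('w, 'a) word_graph \<Rightarrow> 'w \<Rightarrow> ('v \<times> 'w) set" where
  "meet_nodes \<Gamma>\<^sub>0 z\<^sub>0 \<Gamma>\<^sub>1 z\<^sub>1 =
     (GREATEST W. W \<subseteq> nodes \<Gamma>\<^sub>0 \<times> nodes \<Gamma>\<^sub>1 \<and>
        (\<forall>\<alpha>\<in>W. reachable (product_graph_on W \<Gamma>\<^sub>0 \<Gamma>\<^sub>1) (z\<^sub>0, z\<^sub>1) \<alpha>))"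

definition meet_word_graph ::
  "('v, 'a) word_graph \<Rightarrow> 'v \<Rightarrow> ('w, 'a) word_graph \<Rightarrow> 'w \<Rightarrow> ('v \<times> 'w, 'a) word_graph" where
  "meet_word_graph \<Gamma>\<^sub>0 z\<^sub>0 \<Gamma>\<^sub>1 z\<^sub>1 = product_graph_on (meet_nodes \<Gamma>\<^sub>0 z\<^sub>0 \<Gamma>\<^sub>1 z\<^sub>1) \<Gamma>\<^sub>0 \<Gamma>\<^sub>1"

section \<open>Well-definedness\<close>

text \<open>
  The extremal objects chosen by \<^const>\<open>Greatest\<close> and \<^const>\<open>Least\<close> above do exist.
\<close>

lemma right_congruence_meet_eq_Int:
  assumes "right_congruence M \<rho>\<^sub>0" and "right_congruence M \<rho>\<^sub>1"
  shows "right_congruence_meet M \<rho>\<^sub>0 \<rho>\<^sub>1 = \<rho>\<^sub>0 \<inter> \<rho>\<^sub>1"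
  unfolding right_congruence_meet_def
proof (rule Greatest_equality)
  have "equiv (carrier M) (\<rho>\<^sub>0 \<inter> \<rho>\<^sub>1)"
    using assms unfolding right_congruence_def
    by (auto simp: equiv_def refl_on_def intro: sym_Int trans_Int)
  then show "right_congruence M (\<rho>\<^sub>0 \<inter> \<rho>\<^sub>1) \<and> \<rho>\<^sub>0 \<inter> \<rho>\<^sub>1 \<subseteq> \<rho>\<^sub>0 \<and> \<rho>\<^sub>0 \<inter> \<rho>\<^sub>1 \<subseteq> \<rho>\<^sub>1"
    using assms unfolding right_congruence_def by blast
qed blast

lemma generated_congruence_eq_Inter:
  assumes "R \<subseteq> lists A \<times> lists A"
  shows "generated_congruence A R = \<Inter>{\<sigma>. two_sided_congruence (free_monoid A) \<sigma> \<and> R \<subseteq> \<sigma>}"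
    (is "_ = \<Inter>?S")
  unfolding generated_congruence_def
proof (rule Least_equality)
  have top: "lists A \<times> lists A \<in> ?S"
    using assms unfolding two_sided_congruence_def right_congruence_def equiv_def refl_on_def
      sym_def trans_def free_monoid_def by auto
  have "equiv (carrier (free_monoid A)) (\<Inter>?S)"
  proof (rule equivI)
    have eqv: "equiv (carrier (free_monoid A)) \<sigma>" if "\<sigma> \<in> ?S" for \<sigma>
      using that by (simp add: two_sided_congruence_def right_congruence_def)
    show "\<Inter>?S \<subseteq> carrier (free_monoid A) \<times> carrier (free_monoid A)"
      using top by (auto simp: free_monoid_def)
    show "refl_on (carrier (free_monoid A)) (\<Inter>?S)"
      by (auto simp: refl_on_def two_sided_congruence_def right_congruence_def equiv_def)
    show "sym (\<Inter>?S)"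
      by (auto simp: sym_def two_sided_congruence_def right_congruence_def equiv_def)
    show "trans (\<Inter>?S)"
      using eqv trans_INTER[of ?S id] by (simp add: equiv_def)
  qed
  then show "two_sided_congruence (free_monoid A) (\<Inter>?S) \<and> R \<subseteq> \<Inter>?S"
    unfolding two_sided_congruence_def right_congruence_def by blast
qed blast

lemma labels_path_product_graph_on_mono:
  assumes "labels_path (product_graph_on W \<Gamma>\<^sub>0 \<Gamma>\<^sub>1) \<alpha> u \<beta>" and "W \<subseteq> W'"
  shows "labels_path (product_graph_on W' \<Gamma>\<^sub>0 \<Gamma>\<^sub>1) \<alpha> u \<beta>"
  using assms
proof (induction rule: labels_path.induct)
  case (Nil \<alpha>)
  then show ?case by (intro labels_path.Nil) (auto simp: product_graph_on_def)
next
  case (Cons \<alpha> a \<beta> u \<gamma>)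
  then have "(\<alpha>, a, \<beta>) \<in> edges (product_graph_on W' \<Gamma>\<^sub>0 \<Gamma>\<^sub>1)"
    by (auto simp: product_graph_on_def)
  with Cons show ?case by (auto intro: labels_path.Cons)
qed

lemma meet_nodes_eq_Union:
  "meet_nodes \<Gamma>\<^sub>0 z\<^sub>0 \<Gamma>\<^sub>1 z\<^sub>1 =
     \<Union>{W. W \<subseteq> nodes \<Gamma>\<^sub>0 \<times> nodes \<Gamma>\<^sub>1 \<and>
        (\<forall>\<alpha>\<in>W. reachable (product_graph_on W \<Gamma>\<^sub>0 \<Gamma>\<^sub>1) (z\<^sub>0, z\<^sub>1) \<alpha>)}"
    (is "_ = \<Union>?S")
  unfolding meet_nodes_def
proof (rule Greatest_equality)
  have "reachable (product_graph_on (\<Union>?S) \<Gamma>\<^sub>0 \<Gamma>\<^sub>1) (z\<^sub>0, z\<^sub>1) \<alpha>" if "W \<in> ?S" "\<alpha> \<in> W" for W \<alpha>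
    using that labels_path_product_graph_on_mono[of W \<Gamma>\<^sub>0 \<Gamma>\<^sub>1 "(z\<^sub>0, z\<^sub>1)" _ \<alpha> "\<Union>?S"]
    unfolding reachable_def by blast
  then show "\<Union>?S \<subseteq> nodes \<Gamma>\<^sub>0 \<times> nodes \<Gamma>\<^sub>1 \<and>
      (\<forall>\<alpha>\<in>\<Union>?S. reachable (product_graph_on (\<Union>?S) \<Gamma>\<^sub>0 \<Gamma>\<^sub>1) (z\<^sub>0, z\<^sub>1) \<alpha>)"
    by blast
qed blast

end

theory Submission
  imports Defs
begin

text \<open>
  Two words \<open>u\<close>, \<open>v\<close> lead to the same node of the meet word graph iff they lead to the same node
  in each factor, because a path in the product is a pair of paths with a common label. Hence the
  path relation of the meet word graph is the intersection of the path relations of the factors,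
  and the theorem says that the image under \<open>\<theta>\<close> commutes with this intersection. In general an
  image does not; here it does because each path relation is a union of blocks of the kernel of
  \<open>\<theta>\<close>. Indeed, the pairs of words that act in the same way on every node of a complete,
  deterministic and compatible word graph form a two-sided congruence containing \<open>R\<close>, and therefore
  containing \<open>ker \<theta> = R\<^sup>#\<close> (\<open>generated_congruence_same_paths\<close>).

  The other ingredient is that the largest node set defining the meet word graph consists of all
  pairs of nodes reached from the two roots by a common word (\<open>meet_nodes_eq_joint_endpoints\<close>).
  This set is closed under joint edges, so no edge leaving it is lost in the restriction,
  and completeness, determinism and compatibility are inherited from the factors.
\<close>

section \<open>Paths in word graphs\<close>

lemma labels_path_Nil_iff: "labels_path \<Gamma> \<alpha> [] \<beta> \<longleftrightarrow> \<alpha> \<in> nodes \<Gamma> \<and> \<beta> = \<alpha>"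
  by (auto elim: labels_path.cases intro: labels_path.Nil)

lemma labels_path_Cons_iff:
  "labels_path \<Gamma> \<alpha> (a # u) \<gamma> \<longleftrightarrow> (\<exists>\<beta>. (\<alpha>, a, \<beta>) \<in> edges \<Gamma> \<and> labels_path \<Gamma> \<beta> u \<gamma>)"
  by (auto elim: labels_path.cases intro: labels_path.Cons)

lemma labels_path_wf:
  assumes "is_word_graph A \<Gamma>" and "labels_path \<Gamma> \<alpha> u \<beta>"
  shows "\<alpha> \<in> nodes \<Gamma>" and "\<beta> \<in> nodes \<Gamma>" and "u \<in> lists A"
proof -
  have "\<alpha> \<in> nodes \<Gamma> \<and> \<beta> \<in> nodes \<Gamma> \<and> u \<in> lists A"
    using assms(2,1) by (induction rule: labels_path.induct) (auto simp: is_word_graph_def)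
  then show "\<alpha> \<in> nodes \<Gamma>" and "\<beta> \<in> nodes \<Gamma>" and "u \<in> lists A" by auto
qed

lemma labels_path_append_iff:
  assumes "is_word_graph A \<Gamma>"
  shows "labels_path \<Gamma> \<alpha> (u @ v) \<gamma> \<longleftrightarrow> (\<exists>\<beta>. labels_path \<Gamma> \<alpha> u \<beta> \<and> labels_path \<Gamma> \<beta> v \<gamma>)"
proof (induction u arbitrary: \<alpha>)
  case Nil
  then show ?case using labels_path_wf(1)[OF assms] by (auto simp: labels_path_Nil_iff)
next
  case (Cons a u)
  then show ?case by (auto simp: labels_path_Cons_iff)
qed

lemma labels_path_functional:
  assumes "is_word_graph A \<Gamma>" and "deterministic_word_graph A \<Gamma>"
    and "labels_path \<Gamma> \<alpha> u \<beta>" and "labels_path \<Gamma> \<alpha> u \<beta>'"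
  shows "\<beta> = \<beta>'"
  using assms(3,4)
proof (induction arbitrary: \<beta>' rule: labels_path.induct)
  case (Nil \<alpha>)
  then show ?case by (simp add: labels_path_Nil_iff)
next
  case (Cons \<alpha> a \<beta> u \<gamma>)
  then obtain \<delta> where "(\<alpha>, a, \<delta>) \<in> edges \<Gamma>" and "labels_path \<Gamma> \<delta> u \<beta>'"
    by (auto simp: labels_path_Cons_iff)
  moreover from this(1) Cons.hyps(1) have "\<delta> = \<beta>"
    using assms(1,2) unfolding is_word_graph_def deterministic_word_graph_def by blast
  ultimately show ?case using Cons.IH by simp
qed

lemma labels_path_total:
  assumes "is_word_graph A \<Gamma>" and "complete_word_graph A \<Gamma>"
    and "u \<in> lists A" and "\<alpha> \<in> nodes \<Gamma>"
  shows "\<exists>\<beta>. labels_path \<Gamma> \<alpha> u \<beta>"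
  using assms(3,4)
proof (induction u arbitrary: \<alpha>)
  case Nil
  then show ?case by (auto simp: labels_path_Nil_iff)
next
  case (Cons a u)
  then obtain \<beta> where "(\<alpha>, a, \<beta>) \<in> edges \<Gamma>"
    using assms(2) unfolding complete_word_graph_def by blast
  moreover from this have "\<beta> \<in> nodes \<Gamma>" using assms(1) unfolding is_word_graph_def by blast
  ultimately show ?case using Cons.IH unfolding labels_path_Cons_iff by blast
qed

lemma act_eq_Some_iff:
  assumes "is_word_graph A \<Gamma>" and "deterministic_word_graph A \<Gamma>"
  shows "act \<Gamma> \<alpha> u = Some \<beta> \<longleftrightarrow> labels_path \<Gamma> \<alpha> u \<beta>"
proof -
  have "(THE \<beta>. labels_path \<Gamma> \<alpha> u \<beta>) = \<gamma>" if "labels_path \<Gamma> \<alpha> u \<gamma>" for \<gamma>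
    by (rule the_equality) (use that labels_path_functional[OF assms] in blast)+
  then show ?thesis unfolding act_def by auto
qed

lemma path_relation_iff:
  assumes "is_word_graph A \<Gamma>" and "deterministic_word_graph A \<Gamma>"
  shows "(u, v) \<in> path_relation \<Gamma> \<alpha> \<longleftrightarrow> (\<exists>\<beta>. labels_path \<Gamma> \<alpha> u \<beta> \<and> labels_path \<Gamma> \<alpha> v \<beta>)"
  unfolding path_relation_def act_eq_Some_iff[OF assms, symmetric] by auto

lemma compatible_iff:
  fixes \<Gamma> :: "('v, 'a) word_graph"
  assumes "is_word_graph A \<Gamma>" and "deterministic_word_graph A \<Gamma>"
  shows "compatible \<Gamma> R \<longleftrightarrow> (\<forall>u v \<alpha> \<beta> \<gamma>. (u, v) \<in> R \<and> \<alpha> \<in> nodes \<Gamma> \<and>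
    labels_path \<Gamma> \<alpha> u \<beta> \<and> labels_path \<Gamma> \<alpha> v \<gamma> \<longrightarrow> \<beta> = \<gamma>)"
proof -
  have both_defined: "(x \<noteq> None \<and> y \<noteq> None \<longrightarrow> x = y) \<longleftrightarrow> (\<forall>\<beta> \<gamma>. x = Some \<beta> \<and> y = Some \<gamma> \<longrightarrow> \<beta> = \<gamma>)"
    for x y :: "'v option"
    by (cases x; cases y) auto
  then show ?thesis
    unfolding compatible_def both_defined act_eq_Some_iff[OF assms] by blast
qed

section \<open>Path relations and the kernel of the presentation\<close>

text \<open>
  Compatibility constrains only the words related by \<open>R\<close> itself. It extends to all consequences of
  \<open>R\<close> since acting in the same way on every node, not just on the root, is preserved by
  multiplication on the left: the prefix moves the root to some other node.
\<close>
lemma generated_congruence_same_paths: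
  assumes wg: "is_word_graph A \<Gamma>"
    and complete: "complete_word_graph A \<Gamma>" and det: "deterministic_word_graph A \<Gamma>"
    and compat: "compatible \<Gamma> R"
    and R: "R \<subseteq> lists A \<times> lists A"
    and uv: "(u, v) \<in> generated_congruence A R"
  shows "labels_path \<Gamma> \<alpha> u \<beta> \<longleftrightarrow> labels_path \<Gamma> \<alpha> v \<beta>"
proof -
  \<comment> \<open>The binary relation by which a word acts on the nodes. Concatenation of words becomes
    composition of relations, so equality of \<open>walks\<close> is visibly a two-sided congruence.\<close>
  define walks where "walks u = {(\<alpha>, \<beta>). labels_path \<Gamma> \<alpha> u \<beta>}" for u
  define \<sigma> where "\<sigma> = {(u, v). u \<in> lists A \<and> v \<in> lists A \<and> walks u = walks v}"
  have walks_append: "walks (u @ v) = walks u O walks v" for u v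
    unfolding walks_def labels_path_append_iff[OF wg] by blast
  have "equiv (lists A) \<sigma>"
    by (rule equivI) (auto simp: \<sigma>_def refl_on_def sym_def trans_def)
  then have cong: "two_sided_congruence (free_monoid A) \<sigma>"
    unfolding two_sided_congruence_def right_congruence_def free_monoid_def
    by (simp add: \<sigma>_def walks_append)
  have "labels_path \<Gamma> \<alpha> u \<beta> \<longleftrightarrow> labels_path \<Gamma> \<alpha> v \<beta>" if "(u, v) \<in> R" for u v \<alpha> \<beta>
  proof (cases "\<alpha> \<in> nodes \<Gamma>")
    case True
    with that R labels_path_total[OF wg complete] obtain \<gamma> \<delta>
      where "labels_path \<Gamma> \<alpha> u \<gamma>" and "labels_path \<Gamma> \<alpha> v \<delta>" by blast
    with that True compat show ?thesis
      unfolding compatible_iff[OF wg det] using labels_path_functional[OF wg det] by metis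
  next
    case False
    then show ?thesis using labels_path_wf(1)[OF wg] by blast
  qed
  then have "walks u = walks v" if "(u, v) \<in> R" for u v
    using that by (simp add: walks_def)
  with R have "R \<subseteq> \<sigma>" unfolding \<sigma>_def by blast
  with cong uv have "(u, v) \<in> \<sigma>" unfolding generated_congruence_eq_Inter[OF R] by blast
  then show ?thesis unfolding \<sigma>_def walks_def by blast
qed

text \<open>
  Words with the same image under \<open>\<theta>\<close> end at the same node, so membership in a represented
  congruence can be tested on any choice of representing words. This is what lets one pair of words
  serve for two congruences at once.
\<close>
lemma represents_mem_iff:
  assumes pres: "presents A R M \<theta>" and rep: "represents A R M \<theta> \<Gamma> z \<rho>"
    and u: "u \<in> lists A" and v: "v \<in> lists A"
  shows "(\<theta> u, \<theta> v) \<in> \<rho> \<longleftrightarrow> (u, v) \<in> path_relation \<Gamma> z"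
proof
  have R: "R \<subseteq> lists A \<times> lists A"
    and ker: "generated_congruence A R = {(u, v). u \<in> lists A \<and> v \<in> lists A \<and> \<theta> u = \<theta> v}"
    using pres by (auto simp: presents_def)
  have wg: "is_word_graph A \<Gamma>" and complete: "complete_word_graph A \<Gamma>"
    and det: "deterministic_word_graph A \<Gamma>" and compat: "compatible \<Gamma> R"
    and \<rho>: "\<rho> = map_prod \<theta> \<theta> ` path_relation \<Gamma> z"
    using rep by (auto simp: represents_def)
  assume "(\<theta> u, \<theta> v) \<in> \<rho>"
  then obtain u' v' \<beta> where eq: "\<theta> u' = \<theta> u" "\<theta> v' = \<theta> v"
    and paths: "labels_path \<Gamma> z u' \<beta>" "labels_path \<Gamma> z v' \<beta>"
    unfolding \<rho> by (auto simp: path_relation_iff[OF wg det])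
  have "u' \<in> lists A" "v' \<in> lists A" using paths labels_path_wf(3)[OF wg] by blast+
  with eq u v have "(u', u) \<in> generated_congruence A R" "(v', v) \<in> generated_congruence A R"
    by (simp_all add: ker)
  with paths have "labels_path \<Gamma> z u \<beta>" "labels_path \<Gamma> z v \<beta>"
    using generated_congruence_same_paths[OF wg complete det compat R] by blast+
  then show "(u, v) \<in> path_relation \<Gamma> z" by (auto simp: path_relation_iff[OF wg det])
next
  assume "(u, v) \<in> path_relation \<Gamma> z"
  then show "(\<theta> u, \<theta> v) \<in> \<rho>" using rep by (auto simp: represents_def)
qed

section \<open>The meet word graph\<close>

lemma nodes_product_graph_on [simp]: "nodes (product_graph_on W \<Gamma>\<^sub>0 \<Gamma>\<^sub>1) = W"
  by (simp add: product_graph_on_def)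

lemma edges_product_graph_on_iff:
  "((\<alpha>\<^sub>0, \<alpha>\<^sub>1), a, (\<beta>\<^sub>0, \<beta>\<^sub>1)) \<in> edges (product_graph_on W \<Gamma>\<^sub>0 \<Gamma>\<^sub>1) \<longleftrightarrow>
     (\<alpha>\<^sub>0, \<alpha>\<^sub>1) \<in> W \<and> (\<beta>\<^sub>0, \<beta>\<^sub>1) \<in> W \<and> (\<alpha>\<^sub>0, a, \<beta>\<^sub>0) \<in> edges \<Gamma>\<^sub>0 \<and> (\<alpha>\<^sub>1, a, \<beta>\<^sub>1) \<in> edges \<Gamma>\<^sub>1"
  by (simp add: product_graph_on_def)

lemma labels_path_product_graph_onD:
  assumes "labels_path (product_graph_on W \<Gamma>\<^sub>0 \<Gamma>\<^sub>1) (\<alpha>\<^sub>0, \<alpha>\<^sub>1) u (\<beta>\<^sub>0, \<beta>\<^sub>1)"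
    and "W \<subseteq> nodes \<Gamma>\<^sub>0 \<times> nodes \<Gamma>\<^sub>1"
  shows "labels_path \<Gamma>\<^sub>0 \<alpha>\<^sub>0 u \<beta>\<^sub>0" and "labels_path \<Gamma>\<^sub>1 \<alpha>\<^sub>1 u \<beta>\<^sub>1"
proof -
  have "labels_path \<Gamma>\<^sub>0 \<alpha>\<^sub>0 u \<beta>\<^sub>0 \<and> labels_path \<Gamma>\<^sub>1 \<alpha>\<^sub>1 u \<beta>\<^sub>1"
    using assms(1)
  proof (induction u arbitrary: \<alpha>\<^sub>0 \<alpha>\<^sub>1)
    case Nil
    then show ?case using assms(2) by (auto simp: labels_path_Nil_iff)
  next
    case (Cons a u)
    then obtain \<gamma>\<^sub>0 \<gamma>\<^sub>1 where
      "((\<alpha>\<^sub>0, \<alpha>\<^sub>1), a, (\<gamma>\<^sub>0, \<gamma>\<^sub>1)) \<in> edges (product_graph_on W \<Gamma>\<^sub>0 \<Gamma>\<^sub>1)"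
      and "labels_path (product_graph_on W \<Gamma>\<^sub>0 \<Gamma>\<^sub>1) (\<gamma>\<^sub>0, \<gamma>\<^sub>1) u (\<beta>\<^sub>0, \<beta>\<^sub>1)"
      unfolding labels_path_Cons_iff by auto
    with Cons.IH show ?case unfolding labels_path_Cons_iff edges_product_graph_on_iff by blast
  qed
  then show "labels_path \<Gamma>\<^sub>0 \<alpha>\<^sub>0 u \<beta>\<^sub>0" and "labels_path \<Gamma>\<^sub>1 \<alpha>\<^sub>1 u \<beta>\<^sub>1" by auto
qed

definition joint_endpoints ::
  "('v, 'a) word_graph \<Rightarrow> 'v \<Rightarrow> ('w, 'a) word_graph \<Rightarrow> 'w \<Rightarrow> ('v \<times> 'w) set" where
  "joint_endpoints \<Gamma>\<^sub>0 z\<^sub>0 \<Gamma>\<^sub>1 z\<^sub>1 =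
     {(\<beta>\<^sub>0, \<beta>\<^sub>1). \<exists>u. labels_path \<Gamma>\<^sub>0 z\<^sub>0 u \<beta>\<^sub>0 \<and> labels_path \<Gamma>\<^sub>1 z\<^sub>1 u \<beta>\<^sub>1}"

lemma joint_endpoints_step:
  assumes "is_word_graph A \<Gamma>\<^sub>0" and "is_word_graph A \<Gamma>\<^sub>1"
    and "(\<alpha>\<^sub>0, \<alpha>\<^sub>1) \<in> joint_endpoints \<Gamma>\<^sub>0 z\<^sub>0 \<Gamma>\<^sub>1 z\<^sub>1"
    and "(\<alpha>\<^sub>0, a, \<beta>\<^sub>0) \<in> edges \<Gamma>\<^sub>0" and "(\<alpha>\<^sub>1, a, \<beta>\<^sub>1) \<in> edges \<Gamma>\<^sub>1"
  shows "(\<beta>\<^sub>0, \<beta>\<^sub>1) \<in> joint_endpoints \<Gamma>\<^sub>0 z\<^sub>0 \<Gamma>\<^sub>1 z\<^sub>1"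
proof -
  obtain u where "labels_path \<Gamma>\<^sub>0 z\<^sub>0 u \<alpha>\<^sub>0" and "labels_path \<Gamma>\<^sub>1 z\<^sub>1 u \<alpha>\<^sub>1"
    using assms(3) by (auto simp: joint_endpoints_def)
  moreover have "labels_path \<Gamma>\<^sub>0 \<alpha>\<^sub>0 [a] \<beta>\<^sub>0" and "labels_path \<Gamma>\<^sub>1 \<alpha>\<^sub>1 [a] \<beta>\<^sub>1"
    using assms(1,2,4,5) by (auto simp: labels_path_Cons_iff labels_path_Nil_iff is_word_graph_def)
  ultimately have "labels_path \<Gamma>\<^sub>0 z\<^sub>0 (u @ [a]) \<beta>\<^sub>0" and "labels_path \<Gamma>\<^sub>1 z\<^sub>1 (u @ [a]) \<beta>\<^sub>1"
    unfolding labels_path_append_iff[OF assms(1)] labels_path_append_iff[OF assms(2)]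
    by (iprover intro: exI conjI)+
  then show ?thesis by (auto simp: joint_endpoints_def)
qed

lemma joint_endpoints_subset:
  assumes "is_word_graph A \<Gamma>\<^sub>0" and "is_word_graph A \<Gamma>\<^sub>1"
  shows "joint_endpoints \<Gamma>\<^sub>0 z\<^sub>0 \<Gamma>\<^sub>1 z\<^sub>1 \<subseteq> nodes \<Gamma>\<^sub>0 \<times> nodes \<Gamma>\<^sub>1"
  using labels_path_wf(2)[OF assms(1)] labels_path_wf(2)[OF assms(2)]
  by (auto simp: joint_endpoints_def)

text \<open>
  The restriction to joint endpoints destroys no pair of paths, since all intermediate pairs of
  nodes are again joint endpoints.
\<close>
lemma labels_path_joint_endpoints_iff:
  assumes "is_word_graph A \<Gamma>\<^sub>0" and "is_word_graph A \<Gamma>\<^sub>1"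
    and "(\<alpha>\<^sub>0, \<alpha>\<^sub>1) \<in> joint_endpoints \<Gamma>\<^sub>0 z\<^sub>0 \<Gamma>\<^sub>1 z\<^sub>1"
  shows "labels_path (product_graph_on (joint_endpoints \<Gamma>\<^sub>0 z\<^sub>0 \<Gamma>\<^sub>1 z\<^sub>1) \<Gamma>\<^sub>0 \<Gamma>\<^sub>1) (\<alpha>\<^sub>0, \<alpha>\<^sub>1) u (\<beta>\<^sub>0, \<beta>\<^sub>1)
    \<longleftrightarrow> labels_path \<Gamma>\<^sub>0 \<alpha>\<^sub>0 u \<beta>\<^sub>0 \<and> labels_path \<Gamma>\<^sub>1 \<alpha>\<^sub>1 u \<beta>\<^sub>1" (is "?P \<longleftrightarrow> ?Q")
proof
  show "?P \<Longrightarrow> ?Q"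
    using labels_path_product_graph_onD[OF _ joint_endpoints_subset[OF assms(1,2)]] by simp
  show "?Q \<Longrightarrow> ?P" using assms(3)
  proof (induction u arbitrary: \<alpha>\<^sub>0 \<alpha>\<^sub>1)
    case Nil
    then show ?case by (auto simp: labels_path_Nil_iff)
  next
    case (Cons a u)
    then obtain \<gamma>\<^sub>0 \<gamma>\<^sub>1 where edges: "(\<alpha>\<^sub>0, a, \<gamma>\<^sub>0) \<in> edges \<Gamma>\<^sub>0" "(\<alpha>\<^sub>1, a, \<gamma>\<^sub>1) \<in> edges \<Gamma>\<^sub>1"
      and paths: "labels_path \<Gamma>\<^sub>0 \<gamma>\<^sub>0 u \<beta>\<^sub>0" "labels_path \<Gamma>\<^sub>1 \<gamma>\<^sub>1 u \<beta>\<^sub>1"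
      by (auto simp: labels_path_Cons_iff)
    have \<gamma>: "(\<gamma>\<^sub>0, \<gamma>\<^sub>1) \<in> joint_endpoints \<Gamma>\<^sub>0 z\<^sub>0 \<Gamma>\<^sub>1 z\<^sub>1"
      using joint_endpoints_step[OF assms(1,2) Cons.prems(2) edges] .
    show ?case
    proof (rule labels_path.Cons)
      show "((\<alpha>\<^sub>0, \<alpha>\<^sub>1), a, (\<gamma>\<^sub>0, \<gamma>\<^sub>1))
          \<in> edges (product_graph_on (joint_endpoints \<Gamma>\<^sub>0 z\<^sub>0 \<Gamma>\<^sub>1 z\<^sub>1) \<Gamma>\<^sub>0 \<Gamma>\<^sub>1)"
        using edges \<gamma> Cons.prems(2) by (simp add: edges_product_graph_on_iff)
    qed (rule Cons.IH[OF conjI[OF paths] \<gamma>])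
  qed
qed

lemma meet_nodes_eq_joint_endpoints:
  assumes wg: "is_word_graph A \<Gamma>\<^sub>0" "is_word_graph A \<Gamma>\<^sub>1"
    and z: "z\<^sub>0 \<in> nodes \<Gamma>\<^sub>0" "z\<^sub>1 \<in> nodes \<Gamma>\<^sub>1"
  shows "meet_nodes \<Gamma>\<^sub>0 z\<^sub>0 \<Gamma>\<^sub>1 z\<^sub>1 = joint_endpoints \<Gamma>\<^sub>0 z\<^sub>0 \<Gamma>\<^sub>1 z\<^sub>1" (is "_ = ?J")
proof
  show "meet_nodes \<Gamma>\<^sub>0 z\<^sub>0 \<Gamma>\<^sub>1 z\<^sub>1 \<subseteq> ?J"
  proof
    fix \<beta> assume "\<beta> \<in> meet_nodes \<Gamma>\<^sub>0 z\<^sub>0 \<Gamma>\<^sub>1 z\<^sub>1"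
    then obtain W where W: "W \<subseteq> nodes \<Gamma>\<^sub>0 \<times> nodes \<Gamma>\<^sub>1"
      and "reachable (product_graph_on W \<Gamma>\<^sub>0 \<Gamma>\<^sub>1) (z\<^sub>0, z\<^sub>1) \<beta>"
      unfolding meet_nodes_eq_Union by blast
    then obtain u where "labels_path (product_graph_on W \<Gamma>\<^sub>0 \<Gamma>\<^sub>1) (z\<^sub>0, z\<^sub>1) u (fst \<beta>, snd \<beta>)"
      by (auto simp: reachable_def)
    from labels_path_product_graph_onD[OF this W] show "\<beta> \<in> ?J"
      by (auto simp: joint_endpoints_def split_beta)
  qed
  have "(z\<^sub>0, z\<^sub>1) \<in> ?J" using z by (auto simp: joint_endpoints_def intro: labels_path.Nil)
  note path_iff = labels_path_joint_endpoints_iff[OF wg this]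
  have "reachable (product_graph_on ?J \<Gamma>\<^sub>0 \<Gamma>\<^sub>1) (z\<^sub>0, z\<^sub>1) (\<beta>\<^sub>0, \<beta>\<^sub>1)" if "(\<beta>\<^sub>0, \<beta>\<^sub>1) \<in> ?J" for \<beta>\<^sub>0 \<beta>\<^sub>1
    using that unfolding reachable_def path_iff by (simp add: joint_endpoints_def)
  then have "\<forall>\<alpha>\<in>?J. reachable (product_graph_on ?J \<Gamma>\<^sub>0 \<Gamma>\<^sub>1) (z\<^sub>0, z\<^sub>1) \<alpha>" by auto
  then show "?J \<subseteq> meet_nodes \<Gamma>\<^sub>0 z\<^sub>0 \<Gamma>\<^sub>1 z\<^sub>1"
    unfolding meet_nodes_eq_Union
    by (intro Union_upper CollectI conjI joint_endpoints_subset[OF wg])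
qed

section \<open>The meet of two represented congruences\<close>

lemma right_congruence_Int:
  assumes "right_congruence M \<rho>\<^sub>0" and "right_congruence M \<rho>\<^sub>1"
  shows "right_congruence M (\<rho>\<^sub>0 \<inter> \<rho>\<^sub>1)"
proof -
  have "equiv (carrier M) (\<rho>\<^sub>0 \<inter> \<rho>\<^sub>1)"
    using assms unfolding right_congruence_def
    by (auto simp: equiv_def refl_on_def intro: sym_Int trans_Int)
  then show ?thesis using assms unfolding right_congruence_def by blast
qed

theorem corollary6p5:
  fixes A :: "'a set" and R :: "('a list \<times> 'a list) set"
    and M :: "('m, 'x) monoid_scheme" and \<theta> :: "'a list \<Rightarrow> 'm"
    and \<Gamma>\<^sub>0 :: "('v, 'a) word_graph" and z\<^sub>0 :: 'v and \<rho>\<^sub>0 :: "('m \<times> 'm) set"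
    and \<Gamma>\<^sub>1 :: "('w, 'a) word_graph" and z\<^sub>1 :: 'w and \<rho>\<^sub>1 :: "('m \<times> 'm) set"
  assumes "presents A R M \<theta>"
    and "represents A R M \<theta> \<Gamma>\<^sub>0 z\<^sub>0 \<rho>\<^sub>0"
    and "represents A R M \<theta> \<Gamma>\<^sub>1 z\<^sub>1 \<rho>\<^sub>1"
  shows "represents A R M \<theta> (meet_word_graph \<Gamma>\<^sub>0 z\<^sub>0 \<Gamma>\<^sub>1 z\<^sub>1) (z\<^sub>0, z\<^sub>1)
           (right_congruence_meet M \<rho>\<^sub>0 \<rho>\<^sub>1)"
proof -
  have rc: "right_congruence M \<rho>\<^sub>0" "right_congruence M \<rho>\<^sub>1"
    and wg: "is_word_graph A \<Gamma>\<^sub>0" "is_word_graph A \<Gamma>\<^sub>1"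
    and z: "z\<^sub>0 \<in> nodes \<Gamma>\<^sub>0" "z\<^sub>1 \<in> nodes \<Gamma>\<^sub>1"
    and complete: "complete_word_graph A \<Gamma>\<^sub>0" "complete_word_graph A \<Gamma>\<^sub>1"
    and det: "deterministic_word_graph A \<Gamma>\<^sub>0" "deterministic_word_graph A \<Gamma>\<^sub>1"
    and compat: "compatible \<Gamma>\<^sub>0 R" "compatible \<Gamma>\<^sub>1 R"
    and \<rho>: "\<rho>\<^sub>0 = map_prod \<theta> \<theta> ` path_relation \<Gamma>\<^sub>0 z\<^sub>0" "\<rho>\<^sub>1 = map_prod \<theta> \<theta> ` path_relation \<Gamma>\<^sub>1 z\<^sub>1"
    using assms(2,3) by (auto simp: represents_def)
  define J where "J = joint_endpoints \<Gamma>\<^sub>0 z\<^sub>0 \<Gamma>\<^sub>1 z\<^sub>1"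
  define \<Gamma>\<^sub>2 where "\<Gamma>\<^sub>2 = product_graph_on J \<Gamma>\<^sub>0 \<Gamma>\<^sub>1"
  have meet: "meet_word_graph \<Gamma>\<^sub>0 z\<^sub>0 \<Gamma>\<^sub>1 z\<^sub>1 = \<Gamma>\<^sub>2"
    unfolding meet_word_graph_def \<Gamma>\<^sub>2_def J_def meet_nodes_eq_joint_endpoints[OF wg z] ..
  have nodes: "nodes \<Gamma>\<^sub>2 = J" by (simp add: \<Gamma>\<^sub>2_def)
  have J_sub: "J \<subseteq> nodes \<Gamma>\<^sub>0 \<times> nodes \<Gamma>\<^sub>1"
    unfolding J_def by (rule joint_endpoints_subset[OF wg])
  have path: "labels_path \<Gamma>\<^sub>2 (\<alpha>\<^sub>0, \<alpha>\<^sub>1) u (\<beta>\<^sub>0, \<beta>\<^sub>1) \<longleftrightarrow>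
      labels_path \<Gamma>\<^sub>0 \<alpha>\<^sub>0 u \<beta>\<^sub>0 \<and> labels_path \<Gamma>\<^sub>1 \<alpha>\<^sub>1 u \<beta>\<^sub>1"
    if "(\<alpha>\<^sub>0, \<alpha>\<^sub>1) \<in> J" for \<alpha>\<^sub>0 \<alpha>\<^sub>1 u \<beta>\<^sub>0 \<beta>\<^sub>1
    unfolding \<Gamma>\<^sub>2_def J_def using labels_path_joint_endpoints_iff[OF wg] that by (simp add: J_def)
  have root: "(z\<^sub>0, z\<^sub>1) \<in> J"
    using z by (auto simp: J_def joint_endpoints_def intro: labels_path.Nil)
  have wg2: "is_word_graph A \<Gamma>\<^sub>2"
    using wg unfolding is_word_graph_def \<Gamma>\<^sub>2_def by (auto simp: product_graph_on_def)
  have det2: "deterministic_word_graph A \<Gamma>\<^sub>2"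
    unfolding deterministic_word_graph_def nodes
  proof (intro ballI allI impI)
    fix \<alpha> a \<beta> \<beta>'
    assume "\<alpha> \<in> J" and "a \<in> A" and "(\<alpha>, a, \<beta>) \<in> edges \<Gamma>\<^sub>2 \<and> (\<alpha>, a, \<beta>') \<in> edges \<Gamma>\<^sub>2"
    then show "\<beta> = \<beta>'"
      using det J_sub unfolding deterministic_word_graph_def \<Gamma>\<^sub>2_def
      by (cases \<alpha>, cases \<beta>, cases \<beta>') (auto simp: edges_product_graph_on_iff)
  qed
  have complete2: "complete_word_graph A \<Gamma>\<^sub>2"
    unfolding complete_word_graph_def nodes
  proof (intro ballI)
    fix \<alpha> a
    assume "\<alpha> \<in> J" and a: "a \<in> A"
    then obtain \<alpha>\<^sub>0 \<alpha>\<^sub>1 where \<alpha>: "\<alpha> = (\<alpha>\<^sub>0, \<alpha>\<^sub>1)" "(\<alpha>\<^sub>0, \<alpha>\<^sub>1) \<in> J" by (cases \<alpha>) auto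
    with a J_sub obtain \<beta>\<^sub>0 \<beta>\<^sub>1 where edges: "(\<alpha>\<^sub>0, a, \<beta>\<^sub>0) \<in> edges \<Gamma>\<^sub>0" "(\<alpha>\<^sub>1, a, \<beta>\<^sub>1) \<in> edges \<Gamma>\<^sub>1"
      using complete unfolding complete_word_graph_def by blast
    then have "(\<beta>\<^sub>0, \<beta>\<^sub>1) \<in> J" using joint_endpoints_step[OF wg] \<alpha>(2) unfolding J_def by blast
    with edges \<alpha> show "\<exists>\<beta>. (\<alpha>, a, \<beta>) \<in> edges \<Gamma>\<^sub>2"
      unfolding \<Gamma>\<^sub>2_def by (auto simp: edges_product_graph_on_iff)
  qed
  have compat2: "compatible \<Gamma>\<^sub>2 R"
    unfolding compatible_iff[OF wg2 det2] nodes
  proof (intro allI impI)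
    fix u v \<alpha> \<beta> \<gamma>
    assume "(u, v) \<in> R \<and> \<alpha> \<in> J \<and> labels_path \<Gamma>\<^sub>2 \<alpha> u \<beta> \<and> labels_path \<Gamma>\<^sub>2 \<alpha> v \<gamma>"
    then show "\<beta> = \<gamma>"
      using compat J_sub
      unfolding compatible_iff[OF wg(1) det(1)] compatible_iff[OF wg(2) det(2)]
      by (cases \<alpha>, cases \<beta>, cases \<gamma>) (auto simp: path, blast+)
  qed
  have reach2: "\<forall>\<alpha>\<in>J. reachable \<Gamma>\<^sub>2 (z\<^sub>0, z\<^sub>1) \<alpha>"
    using path[OF root] unfolding reachable_def by (auto simp: J_def joint_endpoints_def)
  have rel2: "path_relation \<Gamma>\<^sub>2 (z\<^sub>0, z\<^sub>1) = path_relation \<Gamma>\<^sub>0 z\<^sub>0 \<inter> path_relation \<Gamma>\<^sub>1 z\<^sub>1"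
    by (auto simp: path_relation_iff[OF wg2 det2] path_relation_iff[OF wg(1) det(1)]
        path_relation_iff[OF wg(2) det(2)] path[OF root]) blast
  have "\<rho>\<^sub>0 \<inter> \<rho>\<^sub>1 \<subseteq> map_prod \<theta> \<theta> ` path_relation \<Gamma>\<^sub>2 (z\<^sub>0, z\<^sub>1)"
  proof
    fix p assume p: "p \<in> \<rho>\<^sub>0 \<inter> \<rho>\<^sub>1"
    then obtain u v where p_eq: "p = (\<theta> u, \<theta> v)" and uv: "(u, v) \<in> path_relation \<Gamma>\<^sub>1 z\<^sub>1"
      unfolding \<rho> by auto
    then have "u \<in> lists A" and "v \<in> lists A"
      using labels_path_wf(3)[OF wg(2)] by (auto simp: path_relation_iff[OF wg(2) det(2)])
    \<comment> \<open>The words come from the second graph, but membership in \<open>\<rho>\<^sub>0\<close> may be tested on them too.\<close>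
    with p p_eq have "(u, v) \<in> path_relation \<Gamma>\<^sub>0 z\<^sub>0"
      using represents_mem_iff[OF assms(1,2)] by blast
    with uv p_eq show "p \<in> map_prod \<theta> \<theta> ` path_relation \<Gamma>\<^sub>2 (z\<^sub>0, z\<^sub>1)" unfolding rel2 by auto
  qed
  moreover have "map_prod \<theta> \<theta> ` path_relation \<Gamma>\<^sub>2 (z\<^sub>0, z\<^sub>1) \<subseteq> \<rho>\<^sub>0 \<inter> \<rho>\<^sub>1"
    unfolding rel2 \<rho> by blast
  ultimately have "\<rho>\<^sub>0 \<inter> \<rho>\<^sub>1 = map_prod \<theta> \<theta> ` path_relation \<Gamma>\<^sub>2 (z\<^sub>0, z\<^sub>1)" by blast
  then show ?thesis
    unfolding represents_def meet right_congruence_meet_eq_Int[OF rc] nodes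
    using right_congruence_Int[OF rc] wg2 root complete2 det2 compat2 reach2 by blast
qed

end
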